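(* Let $(\Omega,\mathcal{F},P)$ be an atomless probability space, let $m\colon[0,1]\to[0,1]$ be an increasing bijection, and let $\tau$ be a random variable on $(\Omega,\mathcal{F},P)$ that takes values in $[0,1]$. Let $\mathfrak{M}_m$ be the class of random processes defined in the context. Then $$\inf_{\xi\in\mathfrak{M}_m}\mathbf{E}\,\xi_\tau=\int_0^1 m^{-1}\left(\int_{1-y}^1 r_\tau(s)\,ds\right)dy .$$ If in addition $m(t)=t$ for all $t\in[0,1]$, then $$\inf_{\xi\in\mathfrak{M}_m}\mathbf{E}\,\xi_\tau=\int_0^1 r_\tau(s)\,s\,ds .$$
   Context: $\mathbf{E}$ denotes expectation and $\mu$ denotes the one-dimensional Lebesgue measure on $[0,1]$. A set $A\in\mathcal{F}$ is an atom if $P(A)>0$ and for each $B\in\mathcal{F}$ with $B\subset A$ either $P(B)=0$ or $P(A\setminus B)=0$; the space is atomless if it has no atoms. The class $\mathfrak{M}_m$ consists of all measurable random processes $\xi=\{\xi_t, t\in[0,1]\}$ on $(\Omega,\mathcal{F},P)$ (i.e. $(t,\omega)\mapsto\xi_t(\omega)$ is jointly measurable) such that (i) for almost all $\omega\in\Omega$, one has $0\le\xi_s(\omega)\le\xi_t(\omega)\le 1$ for all $0\le s<t\le 1$; (ii) $\mathbf{E}\,\mu\{t\in[0,1]\colon \xi_t>s\}\ge 1-m(s)$ for all $s\in[0,1]$. The random variable $\xi_\tau$ is $\omega\mapsto\xi_{\tau(\omega)}(\omega)$. The non-increasing rearrangement of $\tau$ is the function $r_\tau\colon[0,1]\to[0,\infty)$,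 $r_\tau(t)=\inf\{s\ge 0\colon m_\tau(s)\le t\}$, where $m_\tau(s)=P\{\omega\in\Omega\colon |\tau(\omega)|>s\}$, $s\ge0$. *)

theory Defs
  imports "HOL-Probability.Probability"
begin

definition is_atom :: "'a measure \<Rightarrow> 'a set \<Rightarrow> bool" where
  "is_atom M A \<longleftrightarrow> A \<in> sets M \<and> measure M A > 0 \<and>
     (\<forall>B\<in>sets M. B \<subseteq> A \<longrightarrow> measure M B = 0 \<or> measure M (A - B) = 0)"

definition atomless :: "'a measure \<Rightarrow> bool" where
  "atomless M \<longleftrightarrow> (\<nexists>A. is_atom M A)"

(* Processes indexed by [0,1] are functions on all of real; only their restriction to [0,1]
   is constrained or used. The [0,1]-bounds in the second clause hold only almost surely,
   and the exceptional null set does not depend on the times s and t. *)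
definition process_class :: "'a measure \<Rightarrow> (real \<Rightarrow> real) \<Rightarrow> (real \<Rightarrow> 'a \<Rightarrow> real) set" where
  "process_class M m = {\<xi>.
     (\<lambda>(t, \<omega>). \<xi> t \<omega>) \<in> borel_measurable (restrict_space borel {0..1} \<Otimes>\<^sub>M M) \<and>
     (AE \<omega> in M. \<forall>s t. 0 \<le> s \<and> s < t \<and> t \<le> 1 \<longrightarrow>
        0 \<le> \<xi> s \<omega> \<and> \<xi> s \<omega> \<le> \<xi> t \<omega> \<and> \<xi> t \<omega> \<le> 1) \<and>
     (\<forall>s\<in>{0..1}. (\<integral>\<omega>. measure lborel {t\<in>{0..1}. \<xi> t \<omega> > s} \<partial>M) \<ge> 1 - m s)}"

definition tail_prob :: "'a measure \<Rightarrow> ('a \<Rightarrow> real) \<Rightarrow> real \<Rightarrow> real" where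
  "tail_prob M \<tau> s = measure M {\<omega>\<in>space M. \<bar>\<tau> \<omega>\<bar> > s}"

definition rearrangement :: "'a measure \<Rightarrow> ('a \<Rightarrow> real) \<Rightarrow> real \<Rightarrow> real" where
  "rearrangement M \<tau> t = Inf {s. 0 \<le> s \<and> tail_prob M \<tau> s \<le> t}"

end

theory Submission
  imports Defs
begin

text \<open>For \<open>A = {\<xi>\<^sub>\<tau> \<le> s}\<close>, monotonicity of the paths and the constraint on \<open>\<xi>\<close> give
  \<open>E(\<tau>; A) \<le> m(s)\<close>, while a rearrangement inequality gives \<open>R(P(A)) \<le> E(\<tau>; A)\<close>, where \<open>R(y)\<close>
  is the integral of the rearrangement of \<open>\<tau>\<close> over \<open>[1 - y, 1]\<close>. So with \<open>g = m\<^sup>-\<^sup>1 \<circ> R\<close> the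
  distribution function \<open>F\<close> of \<open>\<xi>\<^sub>\<tau>\<close> satisfies \<open>g(F(s)) \<le> s\<close>, and integrating the tails over \<open>s\<close>
  yields \<open>E \<xi>\<^sub>\<tau> \<ge> \<integral> g\<close>. Equality holds for \<open>\<xi>\<^sub>t = g(U)\<close> if \<open>t \<le> \<tau>\<close> and \<open>\<xi>\<^sub>t = 1\<close> otherwise,
  where \<open>U\<close> is uniform on \<open>[0, 1]\<close> and comonotone with \<open>\<tau>\<close>. On an atomless space such a \<open>U\<close> is read
  off from a maximal almost-sure chain of events that contains all the \<open>{\<tau> \<le> s}\<close>.\<close>

section \<open>Chains of events modulo null sets\<close>

definition ae_subset :: "'a measure \<Rightarrow> 'a set \<Rightarrow> 'a set \<Rightarrow> bool" where
  "ae_subset M A B \<longleftrightarrow> (AE x in M. x \<in> A \<longrightarrow> x \<in> B)"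

definition ae_comparable :: "'a measure \<Rightarrow> 'a set \<Rightarrow> 'a set \<Rightarrow> bool" where
  "ae_comparable M A B \<longleftrightarrow> ae_subset M A B \<or> ae_subset M B A"

lemma ae_subset_subset: "A \<subseteq> B \<Longrightarrow> ae_subset M A B"
  by (auto simp: ae_subset_def)

lemma ae_subset_trans: "ae_subset M A B \<Longrightarrow> ae_subset M B C \<Longrightarrow> ae_subset M A C"
  unfolding ae_subset_def by (auto elim!: AE_mp)

lemma ae_subset_Un: "ae_subset M A C \<Longrightarrow> ae_subset M B C \<Longrightarrow> ae_subset M (A \<union> B) C"
  unfolding ae_subset_def by (auto elim!: AE_mp)

lemma ae_subset_UN:
  assumes "countable I" and "\<And>i. i \<in> I \<Longrightarrow> ae_subset M (A i) B"
  shows "ae_subset M (\<Union>i\<in>I. A i) B"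
proof -
  have "AE x in M. \<forall>i\<in>I. x \<in> A i \<longrightarrow> x \<in> B"
    using assms by (subst AE_ball_countable) (auto simp: ae_subset_def)
  then show ?thesis
    unfolding ae_subset_def by (auto elim!: AE_mp)
qed

lemma ae_subset_compl:
  "ae_subset M A B \<Longrightarrow> ae_subset M (space M - B) (space M - A)"
  unfolding ae_subset_def by (auto elim!: AE_mp)

lemma ae_comparable_sym: "ae_comparable M A B \<Longrightarrow> ae_comparable M B A"
  by (auto simp: ae_comparable_def)

lemma ae_comparable_compl:
  "ae_comparable M A B \<Longrightarrow> ae_comparable M (space M - A) (space M - B)"
  using ae_subset_compl by (auto simp: ae_comparable_def)

section \<open>Maximal chains of events in a probability space\<close>

context prob_space
begin

lemma prob_mono_ae_subset: "ae_subset M A B \<Longrightarrow> B \<in> events \<Longrightarrow> prob A \<le> prob B"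
  unfolding ae_subset_def by (rule finite_measure_mono_AE)

text \<open>Almost sure inclusion gives \<open>A \<inter> B\<close> the probability of
  \<open>A\<close>, which is at least that of \<open>B\<close>; nothing is left for
  \<open>B - A\<close>. Hence in a chain the order modulo null sets is decided by probabilities
  alone.\<close>

lemma ae_subset_if_prob_ge:
  assumes "ae_subset M A B" "A \<in> events" "B \<in> events" "prob B \<le> prob A"
  shows "ae_subset M B A"
proof -
  have AB: "prob (A \<inter> B) = prob A"
    using assms by (intro finite_measure_eq_AE) (auto simp: ae_subset_def elim!: AE_mp)
  have "prob (B - A) = prob B - prob (B \<inter> A)"
    using assms by (metis finite_measure_Diff' )
  then have "prob (B - A) = 0"
    using AB assms(4) measure_nonneg[of M "B - A"] by (simp add: Int_commute)
  then have "B - A \<in> null_sets M"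
    using assms by (auto simp: null_sets_def emeasure_eq_measure)
  then have "AE x in M. x \<notin> B - A"
    by (rule AE_not_in)
  then show ?thesis
    by (auto simp: ae_subset_def elim!: AE_mp)
qed

lemma ae_subset_if_comparable:
  assumes "ae_comparable M A B" "A \<in> events" "B \<in> events" "prob A \<le> prob B"
  shows "ae_subset M A B"
  using assms ae_subset_if_prob_ge by (auto simp: ae_comparable_def)

text \<open>Working modulo null sets matters here: two members of a maximal chain for plain inclusion
  may differ by a null set, and then the interpolation argument for atomless spaces breaks down.\<close>

definition max_ae_chain :: "'a set set \<Rightarrow> bool" where
  "max_ae_chain K \<longleftrightarrow> K \<subseteq> events \<and> (\<forall>A\<in>K. \<forall>B\<in>K. ae_comparable M A B) \<and>
     (\<forall>Z\<in>events. (\<forall>A\<in>K. ae_comparable M Z A) \<longrightarrow> Z \<in> K)"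

lemma max_ae_chain_empty: "max_ae_chain K \<Longrightarrow> {} \<in> K"
  by (auto simp: max_ae_chain_def ae_comparable_def ae_subset_subset)

text \<open>Zorn's lemma for the chains containing \<open>C\<close>, ordered by inclusion: two
  events in a union of nested chains lie in a common one, so they are comparable.\<close>

lemma max_ae_chain_extends:
  assumes "C \<subseteq> events" and "\<And>A B. A \<in> C \<Longrightarrow> B \<in> C \<Longrightarrow> ae_comparable M A B"
  obtains K where "max_ae_chain K" "C \<subseteq> K"
proof -
  let ?\<A> = "{K. C \<subseteq> K \<and> K \<subseteq> events \<and> (\<forall>A\<in>K. \<forall>B\<in>K. ae_comparable M A B)}"
  have "\<exists>K\<in>?\<A>. \<forall>X\<in>?\<A>. K \<subseteq> X \<longrightarrow> X = K"
  proof (rule subset_Zorn_nonempty)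
    show "?\<A> \<noteq> {}"
      using assms by auto
    fix \<C> assume ne: "\<C> \<noteq> {}" and ch: "subset.chain ?\<A> \<C>"
    have "ae_comparable M A B" if "X \<in> \<C>" "Y \<in> \<C>" "A \<in> X" "B \<in> Y" for X Y A B
    proof -
      have "X \<subseteq> Y \<or> Y \<subseteq> X" "X \<in> ?\<A>" "Y \<in> ?\<A>"
        using ch that by (auto simp: subset_chain_def)
      then show ?thesis
        using that by blast
    qed
    then have "\<forall>A\<in>\<Union>\<C>. \<forall>B\<in>\<Union>\<C>. ae_comparable M A B"
      by blast
    moreover have "\<C> \<subseteq> ?\<A>"
      using ch by (simp add: subset_chain_def)
    then have "C \<subseteq> \<Union>\<C>" "\<Union>\<C> \<subseteq> events"
      using ne by blast+
    ultimately show "\<Union>\<C> \<in> ?\<A>"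
      by simp
  qed
  then obtain K where K: "K \<in> ?\<A>" and max: "\<And>X. X \<in> ?\<A> \<Longrightarrow> K \<subseteq> X \<Longrightarrow> X = K"
    by auto
  \<comment> \<open>Inclusion-maximality becomes the closure property of
    \<open>max_ae_chain\<close>: adding a comparable event to \<open>K\<close> gives a chain again,
    which must equal \<open>K\<close>.\<close>
  have "Z \<in> K" if "Z \<in> events" "\<And>A. A \<in> K \<Longrightarrow> ae_comparable M Z A" for Z
  proof -
    have "ae_comparable M Z Z"
      by (simp add: ae_comparable_def ae_subset_subset)
    then have "insert Z K \<in> ?\<A>"
      using K that ae_comparable_sym by auto
    then have "insert Z K = K" by (rule max) auto
    then show ?thesis by blast
  qed
  then show thesis
    using that[of K] K by (auto simp: max_ae_chain_def)
qed

text \<open>The union is comparable with every \<open>D\<close> in \<open>K\<close>: either all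
  \<open>A i\<close> lie below \<open>D\<close>, or some \<open>A i\<close> does not, and then
  \<open>D\<close> lies below that \<open>A i\<close> and so below the union. Maximality puts the
  union into \<open>K\<close>.\<close>

lemma max_ae_chain_UN:
  assumes K: "max_ae_chain K" and I: "countable I" and A: "\<And>i. i \<in> I \<Longrightarrow> A i \<in> K"
  shows "(\<Union>i\<in>I. A i) \<in> K"
proof -
  have "ae_comparable M (\<Union>i\<in>I. A i) D" if D: "D \<in> K" for D
  proof (cases "\<forall>i\<in>I. ae_subset M (A i) D")
    case True
    then show ?thesis
      using ae_subset_UN[OF I, of M A D] by (simp add: ae_comparable_def)
  next
    case False
    then obtain i where i: "i \<in> I" "\<not> ae_subset M (A i) D" by auto
    then have "ae_subset M D (A i)"
      using K A D by (auto simp: max_ae_chain_def ae_comparable_def)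
    moreover have "ae_subset M (A i) (\<Union>i\<in>I. A i)"
      using i by (intro ae_subset_subset) auto
    ultimately show ?thesis
      unfolding ae_comparable_def using ae_subset_trans by blast
  qed
  moreover have "(\<Union>i\<in>I. A i) \<in> events"
    using K A I by (intro sets.countable_UN') (auto simp: max_ae_chain_def)
  ultimately show ?thesis
    using K by (simp add: max_ae_chain_def)
qed

text \<open>Complementation reverses almost sure inclusion. This duality yields the least member
  above a level from the greatest member below one.\<close>

lemma max_ae_chain_compl:
  assumes K: "max_ae_chain K"
  shows "max_ae_chain ((\<lambda>A. space M - A) ` K)"
proof -
  have Ke: "K \<subseteq> events" using K by (simp add: max_ae_chain_def)
  show ?thesis
    unfolding max_ae_chain_def
  proof (intro conjI ballI impI)
    show "(\<lambda>A. space M - A) ` K \<subseteq> events"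
      using Ke by auto
    fix A B assume "A \<in> (\<lambda>A. space M - A) ` K" "B \<in> (\<lambda>A. space M - A) ` K"
    then obtain A' B' where "A = space M - A'" "B = space M - B'" "A' \<in> K" "B' \<in> K" by auto
    then show "ae_comparable M A B"
      using K by (simp add: max_ae_chain_def ae_comparable_compl)
  next
    fix Z assume Z: "Z \<in> events" and "\<forall>A\<in>(\<lambda>A. space M - A) ` K. ae_comparable M Z A"
    then have *: "ae_comparable M Z (space M - A)" if "A \<in> K" for A using that by blast
    have "ae_comparable M (space M - Z) A" if "A \<in> K" for A
      using ae_comparable_compl[OF *[OF that]] that Ke sets.sets_into_space[of A M]
      by (auto simp: double_diff)
    then have "space M - Z \<in> K"
      using K Z by (auto simp: max_ae_chain_def)
    then show "Z \<in> (\<lambda>A. space M - A) ` K"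
      using sets.sets_into_space[OF Z] by (intro image_eqI[of _ _ "space M - Z"]) auto
  qed
qed

text \<open>The supremum of the probabilities not exceeding \<open>c\<close> is attained by the
  union of a sequence of members approaching it.\<close>

lemma max_ae_chain_lower:
  assumes K: "max_ae_chain K" and c: "0 \<le> c"
  obtains B where "B \<in> K" "prob B \<le> c" "\<And>X. X \<in> K \<Longrightarrow> prob X \<le> c \<Longrightarrow> prob X \<le> prob B"
proof -
  define S where "S = {X \<in> K. prob X \<le> c}"
  have Ke: "K \<subseteq> events" using K by (simp add: max_ae_chain_def)
  have ne: "{} \<in> S"
    using max_ae_chain_empty[OF K] c by (simp add: S_def)
  have bdd: "bdd_above (prob ` S)"
    by (auto simp: S_def intro!: bdd_aboveI[of _ c])
  have "\<exists>X\<in>S. (SUP X\<in>S. prob X) - 1 / Suc n < prob X" for n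
    using ne bdd less_cSUP_iff[of S prob "(SUP X\<in>S. prob X) - 1 / Suc n"] by auto
  then obtain X where X: "\<And>n. X n \<in> S" "\<And>n. (SUP X\<in>S. prob X) - 1 / Suc n < prob (X n)"
    by metis
  \<comment> \<open>Finite unions make the sequence increasing, as continuity from below requires.
    They stay within the bound \<open>c\<close> because the union of two comparable events agrees
    almost surely with the larger one.\<close>
  have un: "(\<Union>i\<in>{..n}. X i) \<in> S" for n
  proof (induction n)
    case 0
    then show ?case using X by simp
  next
    case (Suc n)
    let ?A = "\<Union>i\<in>{..n}. X i"
    have A: "?A \<in> S" "X (Suc n) \<in> S" using Suc X by auto
    have eq: "(\<Union>i\<in>{..Suc n}. X i) = ?A \<union> X (Suc n)" by (auto simp: le_Suc_eq)
    have in_K: "(\<Union>i\<in>{..Suc n}. X i) \<in> K"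
      using X by (intro max_ae_chain_UN[OF K]) (auto simp: S_def)
    have "ae_comparable M ?A (X (Suc n))"
      using A K by (auto simp: S_def max_ae_chain_def)
    then have "prob (?A \<union> X (Suc n)) \<le> c"
    proof (unfold ae_comparable_def, elim disjE)
      assume "ae_subset M ?A (X (Suc n))"
      then have "ae_subset M (?A \<union> X (Suc n)) (X (Suc n))"
        by (intro ae_subset_Un) (auto simp: ae_subset_subset)
      then show ?thesis
        using prob_mono_ae_subset[of "?A \<union> X (Suc n)" "X (Suc n)"] A Ke by (auto simp: S_def)
    next
      assume "ae_subset M (X (Suc n)) ?A"
      then have "ae_subset M (?A \<union> X (Suc n)) ?A"
        by (intro ae_subset_Un) (auto simp: ae_subset_subset)
      then show ?thesis
        using prob_mono_ae_subset[of "?A \<union> X (Suc n)" ?A] A Ke by (auto simp: S_def)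
    qed
    then show ?case
      using in_K by (simp add: S_def eq)
  qed
  let ?B = "\<Union>n. \<Union>i\<in>{..n}. X i"
  have BK: "?B \<in> K"
    using X by (intro max_ae_chain_UN[OF K]) (auto simp: S_def)
  have lim: "(\<lambda>n. prob (\<Union>i\<in>{..n}. X i)) \<longlonglongrightarrow> prob ?B"
    using un Ke by (intro finite_Lim_measure_incseq) (fastforce simp: S_def incseq_def)+
  have "prob ?B \<le> c"
    using lim un by (intro LIMSEQ_le_const2[OF lim]) (auto simp: S_def)
  moreover have "prob Y \<le> prob ?B" if Y: "Y \<in> K" "prob Y \<le> c" for Y
  proof -
    have "prob Y \<le> (SUP X\<in>S. prob X)"
      using Y bdd by (intro cSUP_upper) (auto simp: S_def)
    moreover have "(SUP X\<in>S. prob X) - 1 / Suc n \<le> prob ?B" for n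
    proof -
      have "prob (X n) \<le> prob ?B"
        using BK Ke by (intro finite_measure_mono) auto
      with X(2)[of n] show ?thesis by simp
    qed
    then have "(SUP X\<in>S. prob X) \<le> prob ?B"
    proof (rule_tac ccontr)
      assume sup_le: "\<And>n. (SUP X\<in>S. prob X) - 1 / Suc n \<le> prob ?B"
        and "\<not> (SUP X\<in>S. prob X) \<le> prob ?B"
      then obtain n where "1 / Suc n < (SUP X\<in>S. prob X) - prob ?B"
        by (metis diff_gt_0_iff_gt not_le nat_approx_posE)
      with sup_le[of n] show False by linarith
    qed
    ultimately show ?thesis by simp
  qed
  ultimately show thesis
    using that BK by blast
qed

lemma max_ae_chain_upper:
  assumes K: "max_ae_chain K" and c: "c \<le> 1"
  obtains D where "D \<in> K" "c \<le> prob D" "\<And>X. X \<in> K \<Longrightarrow> c \<le> prob X \<Longrightarrow> prob D \<le> prob X"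
proof -
  have Ke: "K \<subseteq> events" using K by (simp add: max_ae_chain_def)
  obtain B where B: "B \<in> (\<lambda>A. space M - A) ` K" "prob B \<le> 1 - c"
    "\<And>X. X \<in> (\<lambda>A. space M - A) ` K \<Longrightarrow> prob X \<le> 1 - c \<Longrightarrow> prob X \<le> prob B"
    using max_ae_chain_lower[OF max_ae_chain_compl[OF K], of "1 - c"] c by auto
  then obtain D where D: "D \<in> K" "B = space M - D" by auto
  have pc: "prob (space M - X) = 1 - prob X" if "X \<in> K" for X
    using that Ke by (intro prob_compl) auto
  show thesis
  proof (rule that[OF D(1)])
    show "c \<le> prob D" using B(2) D pc by simp
    fix X assume "X \<in> K" "c \<le> prob X"
    then show "prob D \<le> prob X"
      using B(3)[of "space M - X"] D pc by simp
  qed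
qed

text \<open>If \<open>c\<close> were skipped, let \<open>B\<close> be the greatest member below it
  and \<open>D\<close> the least above. The difference \<open>D - B\<close> has positive probability
  and is no atom, so a proper part \<open>E\<close> can be split off. Then
  \<open>B \<union> E\<close> is comparable with the whole chain and belongs to it, yet its
  probability lies strictly between those of \<open>B\<close> and \<open>D\<close>.\<close>

lemma max_ae_chain_prob_surj:
  assumes at: "atomless M" and K: "max_ae_chain K" and c: "0 \<le> c" "c \<le> 1"
  shows "\<exists>X\<in>K. prob X = c"
proof (rule ccontr)
  assume no: "\<not> ?thesis"
  have Ke: "K \<subseteq> events" and cmp: "\<And>A B. A \<in> K \<Longrightarrow> B \<in> K \<Longrightarrow> ae_comparable M A B"
    and max: "\<And>Z. Z \<in> events \<Longrightarrow> (\<And>A. A \<in> K \<Longrightarrow> ae_comparable M Z A) \<Longrightarrow> Z \<in> K"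
    using K by (auto simp: max_ae_chain_def)
  obtain B where B: "B \<in> K" "prob B \<le> c" "\<And>X. X \<in> K \<Longrightarrow> prob X \<le> c \<Longrightarrow> prob X \<le> prob B"
    using max_ae_chain_lower[OF K c(1)] by blast
  obtain D where D: "D \<in> K" "c \<le> prob D" "\<And>X. X \<in> K \<Longrightarrow> c \<le> prob X \<Longrightarrow> prob D \<le> prob X"
    using max_ae_chain_upper[OF K c(2)] by blast
  have [measurable]: "B \<in> events" "D \<in> events" using B D Ke by auto
  have less: "prob B < prob D" using B D no by (metis le_less_trans order_less_le)
  have BD: "ae_subset M B D"
    using cmp B(1) D(1) less by (intro ae_subset_if_comparable) auto
  have "prob D = prob (D \<inter> B) + prob (D - B)"
    using finite_measure_Diff'[of D B] by simp
  moreover have "prob (D \<inter> B) \<le> prob B" by (intro finite_measure_mono) auto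
  ultimately have "prob (D - B) > 0" using less by simp
  then obtain E where E: "E \<in> events" "E \<subseteq> D - B" "prob E \<noteq> 0" "prob (D - B - E) \<noteq> 0"
    using at by (auto simp: atomless_def is_atom_def)
  note [measurable] = E(1)
  let ?W = "B \<union> E"
  have WD: "ae_subset M ?W D"
    using BD E by (intro ae_subset_Un) (auto intro: ae_subset_subset)
  have "?W \<in> K"
  proof (rule max)
    show "?W \<in> events" by simp
    fix X assume X: "X \<in> K"
    show "ae_comparable M ?W X"
    proof (cases "prob X \<le> c")
      case True
      then have "ae_subset M X B"
        using X B cmp Ke by (intro ae_subset_if_comparable) auto
      then have "ae_subset M X ?W"
        using ae_subset_trans ae_subset_subset[of B ?W] by blast
      then show ?thesis by (simp add: ae_comparable_def)
    next
      case False
      then have "ae_subset M D X"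
        using X D cmp Ke by (intro ae_subset_if_comparable) auto
      then show ?thesis
        using WD ae_subset_trans by (auto simp: ae_comparable_def)
    qed
  qed
  have W: "prob ?W = prob B + prob E"
    using E by (intro finite_measure_Union) auto
  have E0: "prob E > 0" and E1: "prob (D - B - E) > 0"
    using E measure_nonneg[of M E] measure_nonneg[of M "D - B - E"] by linarith+
  have "\<not> prob ?W \<le> c" using B(3)[OF \<open>?W \<in> K\<close>] W E0 by auto
  then have "prob D \<le> prob ?W" using D(3)[OF \<open>?W \<in> K\<close>] by simp
  moreover have "prob (?W \<union> (D - B - E)) = prob ?W + prob (D - B - E)"
    by (intro finite_measure_Union) auto
  moreover have "prob (?W \<union> (D - B - E)) \<le> prob D"
    by (intro prob_mono_ae_subset ae_subset_Un[OF WD]) (auto intro: ae_subset_subset)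
  ultimately show False using E1 by linarith
qed

text \<open>A maximal chain through all \<open>{\<tau> \<le> s}\<close> contains an event
  \<open>F c\<close> of each probability \<open>c\<close>. The variable \<open>U\<close> records the
  level at which a point enters this family; \<open>{U \<le> x}\<close> is then almost surely
  \<open>F x\<close>, which is comparable with every \<open>{\<tau> \<le> s}\<close>.\<close>

lemma exists_comonotone_uniform:
  assumes at: "atomless M" and [measurable]: "\<tau> \<in> borel_measurable M"
  obtains U :: "'a \<Rightarrow> real" where "U \<in> borel_measurable M"
    and "\<And>\<omega>. U \<omega> \<in> {0..1}"
    and "\<And>x. x \<in> {0..1} \<Longrightarrow> prob {\<omega>\<in>space M. U \<omega> \<le> x} = x"
    and "\<And>x s. x \<in> {0..1} \<Longrightarrow>
      ae_comparable M {\<omega>\<in>space M. U \<omega> \<le> x} {\<omega>\<in>space M. \<tau> \<omega> \<le> (s::real)}"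
proof -
  have "ae_comparable M {\<omega>\<in>space M. \<tau> \<omega> \<le> s} {\<omega>\<in>space M. \<tau> \<omega> \<le> t}" for s t
  proof (cases "s \<le> t")
    case True
    then show ?thesis
      unfolding ae_comparable_def by (intro disjI1 ae_subset_subset) auto
  next
    case False
    then show ?thesis
      unfolding ae_comparable_def by (intro disjI2 ae_subset_subset) auto
  qed
  then obtain K where K: "max_ae_chain K" and sub: "range (\<lambda>s. {\<omega>\<in>space M. \<tau> \<omega> \<le> s}) \<subseteq> K"
    by (rule_tac max_ae_chain_extends[of "range (\<lambda>s. {\<omega>\<in>space M. \<tau> \<omega> \<le> s})"]) auto
  have Ke: "K \<subseteq> events" and cmp: "\<And>A B. A \<in> K \<Longrightarrow> B \<in> K \<Longrightarrow> ae_comparable M A B"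
    using K by (auto simp: max_ae_chain_def)
  have "\<forall>c\<in>{0..1}. \<exists>X\<in>K. prob X = c"
    using max_ae_chain_prob_surj[OF at K] by auto
  then obtain F where F: "\<And>c. c \<in> {0..1} \<Longrightarrow> F c \<in> K" "\<And>c. c \<in> {0..1} \<Longrightarrow> prob (F c) = c"
    by metis
  \<comment> \<open>Rational levels make \<open>{U < x}\<close> a countable union of events, hence
    measurable.\<close>
  define Q where "Q = \<rat> \<inter> {0..1::real}"
  have Q: "countable Q" "Q \<subseteq> {0..1}" using countable_rat by (auto simp: Q_def)
  \<comment> \<open>The inserted 1 is the value at points lying in no \<open>F q\<close>; it keeps
    the infimum over a non-empty set and within [0,1].\<close>
  define U where "U \<omega> = Inf (insert 1 {q\<in>Q. \<omega> \<in> F q})" for \<omega>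
  have bdd: "bdd_below (insert 1 {q\<in>Q. \<omega> \<in> F q})" for \<omega>
    using Q by (auto intro!: bdd_belowI[of _ 0])
  have U_less: "U \<omega> < x \<longleftrightarrow> 1 < x \<or> (\<exists>q\<in>Q. q < x \<and> \<omega> \<in> F q)" for \<omega> x
    unfolding U_def using bdd[of \<omega>] by (subst cInf_less_iff) auto
  have Fe: "F q \<in> events" if "q \<in> {0..1}" for q using F(1)[OF that] Ke by auto
  have Fs: "F q \<subseteq> space M" if "q \<in> Q" for q
    using Fe[of q] that Q sets.sets_into_space by blast
  have ev: "{\<omega>\<in>space M. U \<omega> < x} = (\<Union>q\<in>{q\<in>Q. q < x}. F q)" if "x \<le> 1" for x
    using that by (auto simp: U_less dest: subsetD[OF Fs])
  have cQ: "countable {q\<in>Q. q < x}" for x using Q by auto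
  have [measurable]: "U \<in> borel_measurable M"
    unfolding borel_measurable_iff_less
  proof
    fix x show "{\<omega>\<in>space M. U \<omega> < x} \<in> events"
    proof (cases "x \<le> 1")
      case True
      then show ?thesis
        using Q Fe by (subst ev) (auto intro!: sets.countable_UN'[OF cQ])
    next
      case False
      then show ?thesis by (simp add: U_less)
    qed
  qed
  have U01: "U \<omega> \<in> {0..1}" for \<omega>
    unfolding U_def using bdd[of \<omega>] Q by (auto intro!: cInf_greatest cInf_lower)
  have sub_F: "ae_subset M {\<omega>\<in>space M. U \<omega> < x} (F x)" if x: "x \<in> {0..1}" for x
    using x Q F Fe cmp by (subst ev) (auto intro!: ae_subset_UN[OF cQ] ae_subset_if_comparable)
  have P_less: "prob {\<omega>\<in>space M. U \<omega> < x} = x" if x: "x \<in> {0..1}" for x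
  proof (rule antisym)
    show "prob {\<omega>\<in>space M. U \<omega> < x} \<le> x"
      using prob_mono_ae_subset[OF sub_F[OF x] Fe[OF x]] F(2)[OF x] by simp
    show "x \<le> prob {\<omega>\<in>space M. U \<omega> < x}"
    proof (rule ccontr)
      assume "\<not> ?thesis"
      then obtain q where q: "q \<in> \<rat>" "prob {\<omega>\<in>space M. U \<omega> < x} < q" "q < x"
        using Rats_dense_in_real[of "prob {\<omega>\<in>space M. U \<omega> < x}" x] by (auto simp: not_le)
      moreover have "0 \<le> q"
        using q(2) measure_nonneg[of M "{\<omega>\<in>space M. U \<omega> < x}"] by linarith
      ultimately have qQ: "q \<in> Q" using x by (auto simp: Q_def)
      have "F q \<subseteq> {\<omega>\<in>space M. U \<omega> < x}"
        using x q qQ by (subst ev) auto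
      then have "prob (F q) \<le> prob {\<omega>\<in>space M. U \<omega> < x}"
        by (intro finite_measure_mono) measurable
      with q qQ F(2)[of q] Q show False by auto
    qed
  qed
  have P_le: "prob {\<omega>\<in>space M. U \<omega> \<le> x} = x" if x: "x \<in> {0..1}" for x
  proof (rule antisym)
    have "prob {\<omega>\<in>space M. U \<omega> < x} \<le> prob {\<omega>\<in>space M. U \<omega> \<le> x}"
      by (intro finite_measure_mono) auto
    then show "x \<le> prob {\<omega>\<in>space M. U \<omega> \<le> x}"
      using P_less[OF x] by simp
    show "prob {\<omega>\<in>space M. U \<omega> \<le> x} \<le> x"
    proof (rule dense_ge)
      fix y assume "x < y"
      show "prob {\<omega>\<in>space M. U \<omega> \<le> x} \<le> y"
      proof (cases "y \<le> 1")
        case True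
        have "prob {\<omega>\<in>space M. U \<omega> \<le> x} \<le> prob {\<omega>\<in>space M. U \<omega> < y}"
          using \<open>x < y\<close> by (intro finite_measure_mono) auto
        with True show ?thesis
          using \<open>x < y\<close> x P_less[of y] by simp
      next
        case False
        then show ?thesis using prob_le_1 by (meson le_cases order_trans)
      qed
    qed
  qed
  \<comment> \<open>Both events have probability \<open>x\<close>, so the one-sided inclusion
    \<open>sub_F\<close> already forces equality modulo null sets.\<close>
  have eqF: "ae_subset M {\<omega>\<in>space M. U \<omega> \<le> x} (F x)" "ae_subset M (F x) {\<omega>\<in>space M. U \<omega> \<le> x}"
    if x: "x \<in> {0..1}" for x
  proof -
    have "ae_subset M {\<omega>\<in>space M. U \<omega> \<le> x} {\<omega>\<in>space M. U \<omega> < x}"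
      using P_less[OF x] P_le[OF x]
      by (rule_tac ae_subset_if_prob_ge) (auto intro!: ae_subset_subset)
    then show "ae_subset M {\<omega>\<in>space M. U \<omega> \<le> x} (F x)"
      using sub_F[OF x] ae_subset_trans by blast
    then show "ae_subset M (F x) {\<omega>\<in>space M. U \<omega> \<le> x}"
      using P_le[OF x] F(2)[OF x] Fe[OF x] by (rule_tac ae_subset_if_prob_ge) auto
  qed
  have cmp_U: "ae_comparable M {\<omega>\<in>space M. U \<omega> \<le> x} {\<omega>\<in>space M. \<tau> \<omega> \<le> s}" if x: "x \<in> {0..1}" for x s
  proof -
    have "ae_comparable M (F x) {\<omega>\<in>space M. \<tau> \<omega> \<le> s}"
      using sub by (intro cmp F(1)[OF x]) (auto simp: image_subset_iff)
    with eqF[OF x] show ?thesis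
      unfolding ae_comparable_def using ae_subset_trans by blast
  qed
  show thesis
    by (rule that[OF \<open>U \<in> borel_measurable M\<close> U01 P_le cmp_U])
qed

end

section \<open>The rearrangement\<close>

abbreviation unit_lborel :: "real measure" where
  "unit_lborel \<equiv> restrict_space lborel {0..1}"

lemma prob_space_unit_lborel: "prob_space unit_lborel"
  by (rule prob_spaceI) (simp add: space_restrict_space emeasure_restrict_space)

interpretation unit_lborel: prob_space unit_lborel
  by (rule prob_space_unit_lborel)

lemma space_unit_lborel [simp]: "space unit_lborel = {0..1}"
  by (simp add: space_restrict_space)

lemma sets_unit_lborel: "sets unit_lborel = sets (restrict_space borel {0..1})"
  by (simp cong: sets_restrict_space_cong)

lemma measure_unit_lborel:
  assumes "A \<subseteq> {0..1}" "A \<in> sets borel"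
  shows "measure unit_lborel A = measure lborel A"
  using assms by (intro measure_restrict_space) auto

lemma id_measurable_unit_lborel [measurable]: "(\<lambda>x. x) \<in> borel_measurable unit_lborel"
  by (intro measurable_restrict_space1) simp

lemma borel_measurable_unit_lborel_mono_on:
  fixes f :: "real \<Rightarrow> real"
  assumes "mono_on {0..1} f"
  shows "f \<in> borel_measurable unit_lborel"
  using borel_measurable_mono_on_fnc[OF assms] by (simp add: measurable_cong_sets[OF sets_unit_lborel refl])

lemma borel_measurable_unit_lborel_antimono_on:
  fixes f :: "real \<Rightarrow> real"
  assumes "antimono_on {0..1} f"
  shows "f \<in> borel_measurable unit_lborel"
proof -
  have "mono_on {0..1} (\<lambda>x. - f x)"
    using assms by (auto simp: monotone_on_def)
  then have "(\<lambda>x. - (- f x)) \<in> borel_measurable unit_lborel"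
    by (intro borel_measurable_uminus borel_measurable_unit_lborel_mono_on)
  then show ?thesis by simp
qed

lemma LINT_unit_lborel:
  fixes f :: "real \<Rightarrow> real"
  shows "(LINT s:{0..1}|lborel. f s) = (\<integral>s. f s \<partial>unit_lborel)"
  by (simp add: set_lebesgue_integral_def integral_restrict_space)

lemma LINT_upper_unit_lborel:
  fixes f :: "real \<Rightarrow> real"
  assumes "y \<in> {0..1}"
  shows "(LINT s:{1 - y..1}|lborel. f s) = (\<integral>s. (if 1 - y \<le> s then f s else 0) \<partial>unit_lborel)"
  unfolding LINT_unit_lborel[symmetric] set_lebesgue_integral_def
  using assms by (intro Bochner_Integration.integral_cong) (auto split: split_indicator)

text \<open>Fubini for the indicator of \<open>s < X \<omega>\<close>: its integral over
  \<open>s\<close> in [0,1] is \<open>X \<omega>\<close>, because \<open>X\<close> takes values in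
  [0,1] almost surely.\<close>

lemma (in prob_space) expectation_layer_cake:
  fixes X :: "'a \<Rightarrow> real"
  assumes [measurable]: "X \<in> borel_measurable M" and X: "AE \<omega> in M. 0 \<le> X \<omega> \<and> X \<omega> \<le> 1"
  shows "expectation X = (\<integral>s. prob {\<omega>\<in>space M. s < X \<omega>} \<partial>unit_lborel)"
proof -
  interpret P: pair_sigma_finite M unit_lborel
    by unfold_locales
  interpret PP: pair_prob_space M unit_lborel
    by unfold_locales
  let ?f = "\<lambda>\<omega> s. if s < X \<omega> then 1 else 0 :: real"
  have "(\<integral>s. prob {\<omega>\<in>space M. s < X \<omega>} \<partial>unit_lborel) = (\<integral>s. (\<integral>\<omega>. ?f \<omega> s \<partial>M) \<partial>unit_lborel)"
  proof (intro Bochner_Integration.integral_cong refl)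
    fix s
    have "(\<integral>\<omega>. ?f \<omega> s \<partial>M) = (\<integral>\<omega>. indicator {\<omega>\<in>space M. s < X \<omega>} \<omega> \<partial>M)"
      by (intro Bochner_Integration.integral_cong) auto
    then show "prob {\<omega>\<in>space M. s < X \<omega>} = (\<integral>\<omega>. ?f \<omega> s \<partial>M)" by simp
  qed
  also have "\<dots> = (\<integral>\<omega>. (\<integral>s. ?f \<omega> s \<partial>unit_lborel) \<partial>M)"
  proof (rule P.Fubini_integral)
    show "integrable (M \<Otimes>\<^sub>M unit_lborel) (\<lambda>(\<omega>, s). ?f \<omega> s)"
      by (rule PP.integrable_const_bound[where B=1]) auto
  qed
  also have "\<dots> = expectation X"
  proof (rule integral_cong_AE)
    show "AE \<omega> in M. (\<integral>s. ?f \<omega> s \<partial>unit_lborel) = X \<omega>"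
      using X
    proof eventually_elim
      fix \<omega> assume x: "0 \<le> X \<omega> \<and> X \<omega> \<le> 1"
      have "(\<integral>s. ?f \<omega> s \<partial>unit_lborel) = (\<integral>s. indicator {0..<X \<omega>} s \<partial>unit_lborel)"
        by (intro Bochner_Integration.integral_cong) auto
      also have "\<dots> = measure unit_lborel {0..<X \<omega>}"
        using x by (simp add: Int_absorb2 subset_eq)
      also have "\<dots> = X \<omega>"
        using x by (subst measure_unit_lborel) auto
      finally show "(\<integral>s. ?f \<omega> s \<partial>unit_lborel) = X \<omega>" .
    qed
  qed measurable
  finally show ?thesis by simp
qed

section \<open>Tail function, rearrangement and the integral \<open>R\<close> of its lower
  values\<close>

locale unit_rv = prob_space +
  fixes \<tau> :: "'a \<Rightarrow> real"
  assumes rv [measurable]: "\<tau> \<in> borel_measurable M"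
    and rv_range: "\<And>\<omega>. \<omega> \<in> space M \<Longrightarrow> \<tau> \<omega> \<in> {0..1}"
begin

abbreviation tail where "tail \<equiv> tail_prob M \<tau>"

abbreviation r where "r \<equiv> rearrangement M \<tau>"

text \<open>\<open>R y\<close> is the least possible value of \<open>E(\<tau>; A)\<close> over events \<open>A\<close> of probability \<open>y\<close>.\<close>

definition R :: "real \<Rightarrow> real" where
  "R y = (\<integral>s. (if 1 - y \<le> s then r s else 0) \<partial>unit_lborel)"

lemma tail_eq: "tail s = prob {\<omega>\<in>space M. s < \<tau> \<omega>}" if "0 \<le> s"
proof -
  have "{\<omega>\<in>space M. \<bar>\<tau> \<omega>\<bar> > s} = {\<omega>\<in>space M. s < \<tau> \<omega>}"
    using rv_range by auto
  then show ?thesis by (simp add: tail_prob_def)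
qed

lemma tail_antimono: "s \<le> t \<Longrightarrow> tail t \<le> tail s"
  unfolding tail_prob_def by (intro finite_measure_mono) auto

lemma tail_bounds: "0 \<le> tail s" "tail s \<le> 1"
  by (auto simp: tail_prob_def)

lemma tail_1: "tail 1 = 0"
proof -
  have "{\<omega>\<in>space M. 1 < \<tau> \<omega>} = {}"
    using rv_range by force
  with tail_eq[of 1] show ?thesis by (simp only: measure_empty zero_le_one)
qed

lemma tail_measurable [measurable]: "tail \<in> borel_measurable unit_lborel"
  by (intro borel_measurable_unit_lborel_antimono_on) (auto simp: monotone_on_def tail_antimono)

text \<open>Right-continuity of the tail, by continuity from below along the events
  \<open>{s + 1/(n+1) < \<tau>}\<close>. It makes the infimum defining the rearrangement
  attained.\<close>

lemma tail_right_cont: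
  assumes "0 \<le> s" and le: "\<And>t. s < t \<Longrightarrow> tail t \<le> u"
  shows "tail s \<le> u"
proof -
  let ?A = "\<lambda>n. {\<omega>\<in>space M. s + 1 / Suc n < \<tau> \<omega>}"
  have "(\<lambda>n. prob (?A n)) \<longlonglongrightarrow> prob (\<Union>n. ?A n)"
  proof (rule finite_Lim_measure_incseq)
    show "incseq ?A"
    proof (rule incseq_SucI)
      fix n
      have "1 / real (Suc (Suc n)) \<le> 1 / real (Suc n)" by (simp add: field_simps)
      then show "?A n \<subseteq> ?A (Suc n)" by auto
    qed
  qed auto
  moreover have "(\<Union>n. ?A n) = {\<omega>\<in>space M. s < \<tau> \<omega>}"
  proof (intro equalityI subsetI)
    fix \<omega> assume w: "\<omega> \<in> {\<omega>\<in>space M. s < \<tau> \<omega>}"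
    then obtain n where "1 / Suc n < \<tau> \<omega> - s"
      using nat_approx_posE[of "\<tau> \<omega> - s"] by auto
    with w show "\<omega> \<in> (\<Union>n. ?A n)"
      by (auto intro!: exI[of _ n])
  next
    fix \<omega> assume "\<omega> \<in> (\<Union>n. ?A n)"
    then obtain n where "\<omega> \<in> space M" "s + 1 / Suc n < \<tau> \<omega>" by auto
    moreover have "s < s + 1 / real (Suc n)" by simp
    ultimately have "\<omega> \<in> space M" "s < \<tau> \<omega>" by linarith+
    then show "\<omega> \<in> {\<omega>\<in>space M. s < \<tau> \<omega>}" by simp
  qed
  moreover have "prob (?A n) \<le> u" for n
  proof -
    have "0 < 1 / real (Suc n)" by simp
    then show ?thesis
      using le[of "s + 1 / Suc n"] tail_eq[of "s + 1 / Suc n"] assms(1) by (simp del: of_nat_Suc)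
  qed
  ultimately show ?thesis
    using tail_eq[OF assms(1)] LIMSEQ_le_const2[of "\<lambda>n. prob (?A n)" _ u] by auto
qed

text \<open>The rearrangement is the generalized inverse of the tail. The forward direction needs
  the infimum to be attained, hence right-continuity.\<close>

lemma rearrangement_le_iff:
  assumes "u \<in> {0..1}" "0 \<le> s"
  shows "r u \<le> s \<longleftrightarrow> tail s \<le> u"
proof -
  let ?S = "{s. 0 \<le> s \<and> tail s \<le> u}"
  have bdd: "bdd_below ?S" and ne: "1 \<in> ?S"
    using assms tail_1 by (auto intro: bdd_belowI[of _ 0])
  show ?thesis
  proof
    assume "tail s \<le> u"
    then show "r u \<le> s"
      unfolding rearrangement_def using assms bdd by (intro cInf_lower) auto
  next
    assume le: "r u \<le> s"
    show "tail s \<le> u"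
    proof (rule tail_right_cont[OF assms(2)])
      fix t assume "s < t"
      then have "Inf ?S < t" using le by (simp add: rearrangement_def)
      then obtain s' where "s' \<in> ?S" "s' < t"
        using cInf_less_iff[of ?S t] bdd ne by blast
      then show "tail t \<le> u"
        using tail_antimono[of s' t] by auto
    qed
  qed
qed

lemma rearrangement_less_iff:
  "u \<in> {0..1} \<Longrightarrow> 0 \<le> s \<Longrightarrow> s < r u \<longleftrightarrow> u < tail s"
  using rearrangement_le_iff[of u s] by linarith

lemma rearrangement_bounds:
  assumes "u \<in> {0..1}"
  shows "0 \<le> r u" "r u \<le> 1"
proof -
  show "r u \<le> 1"
    using assms rearrangement_le_iff[of u 1] tail_1 by simp
  show "0 \<le> r u"
    unfolding rearrangement_def using assms tail_1 by (intro cInf_greatest) (auto intro!: exI[of _ 1])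
qed

lemma rearrangement_measurable [measurable]: "r \<in> borel_measurable unit_lborel"
proof (intro borel_measurable_unit_lborel_antimono_on monotone_onI)
  fix u v :: real assume "u \<in> {0..1}" "v \<in> {0..1}" "u \<le> v"
  then show "r v \<le> r u"
    using rearrangement_le_iff[of u "r u"] rearrangement_le_iff[of v "r u"] rearrangement_bounds[of u]
    by auto
qed

text \<open>By the layer cake formula: for fixed \<open>s\<close> the points
  \<open>u \<ge> 1 - y\<close> with \<open>r u > s\<close> form the interval
  \<open>{1 - y..<tail s}\<close>, whose length is the positive part. In this form the integrand is
  visibly increasing and 1-Lipschitz in \<open>y\<close>.\<close>

lemma R_eq:
  assumes y: "y \<in> {0..1}"
  shows "R y = (\<integral>s. max 0 (tail s - 1 + y) \<partial>unit_lborel)"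
proof -
  have "R y = (\<integral>s. measure unit_lborel {u\<in>space unit_lborel. s < (if 1 - y \<le> u then r u else 0)}
      \<partial>unit_lborel)"
    unfolding R_def
    by (rule unit_lborel.expectation_layer_cake) (auto intro!: AE_I2 simp: rearrangement_bounds)
  also have "\<dots> = (\<integral>s. max 0 (tail s - 1 + y) \<partial>unit_lborel)"
  proof (intro Bochner_Integration.integral_cong refl)
    fix s assume s: "s \<in> space unit_lborel"
    have "{u\<in>space unit_lborel. s < (if 1 - y \<le> u then r u else 0)} = {1 - y..<tail s}"
      using s y rearrangement_less_iff[of _ s] tail_bounds[of s] by (auto split: if_splits)
    moreover have "measure unit_lborel {1 - y..<tail s} = max 0 (tail s - 1 + y)"
      using y tail_bounds[of s]
      by (cases "1 - y \<le> tail s") (auto simp: measure_unit_lborel subset_eq)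
    ultimately show "measure unit_lborel {u\<in>space unit_lborel. s < (if 1 - y \<le> u then r u else 0)}
        = max 0 (tail s - 1 + y)" by simp
  qed
  finally show ?thesis .
qed

lemma R_integrand_integrable:
  assumes "y \<in> {0..1}"
  shows "integrable unit_lborel (\<lambda>s. max 0 (tail s - 1 + y))"
proof (rule unit_lborel.integrable_const_bound[where B=1])
  have "norm (max 0 (tail s - 1 + y)) \<le> 1" for s
    using assms tail_bounds(2)[of s] by auto
  then show "AE s in unit_lborel. norm (max 0 (tail s - 1 + y)) \<le> 1" by simp
qed simp

lemma R_mono: "x \<in> {0..1} \<Longrightarrow> y \<in> {0..1} \<Longrightarrow> x \<le> y \<Longrightarrow> R x \<le> R y"
  unfolding R_eq by (intro integral_mono R_integrand_integrable) auto

lemma R_lipschitz: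
  assumes "x \<in> {0..1}" "y \<in> {0..1}" "x \<le> y"
  shows "R y \<le> R x + (y - x)"
proof -
  have "R y \<le> (\<integral>s. max 0 (tail s - 1 + x) + (y - x) \<partial>unit_lborel)"
    unfolding R_eq[OF assms(2)] using assms
    by (intro integral_mono R_integrand_integrable Bochner_Integration.integrable_add) auto
  also have "\<dots> = R x + (y - x)"
    using assms R_integrand_integrable unit_lborel.prob_space
    by (subst Bochner_Integration.integral_add) (auto simp: R_eq)
  finally show ?thesis .
qed

lemma R_0: "R 0 = 0"
proof -
  have "max 0 (tail s - 1) = 0" for s using tail_bounds[of s] by auto
  then show ?thesis using R_eq[of 0] by simp
qed

lemma R_bounds:
  assumes "y \<in> {0..1}"
  shows "R y \<in> {0..1}"
  using R_mono[of 0 y] R_lipschitz[of 0 y] assms by (auto simp: R_0)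

text \<open>Monotonicity makes the sublevel set an initial segment of [0,1], and the Lipschitz bound
  shows that it contains its supremum \<open>p\<close>.\<close>

lemma R_sublevel:
  assumes c: "0 \<le> c"
  obtains p where "p \<in> {0..1}" "{y\<in>{0..1}. R y \<le> c} = {0..p}"
proof -
  let ?S = "{y\<in>{0..1}. R y \<le> c}"
  have bdd: "bdd_above ?S" and ne: "0 \<in> ?S"
    using c by (auto intro: bdd_aboveI[of _ 1] simp: R_0)
  define p where "p = Sup ?S"
  have p0: "0 \<le> p" unfolding p_def using ne bdd by (rule cSup_upper)
  have p1: "p \<le> 1" unfolding p_def by (rule cSup_least) (use ne in \<open>blast, simp\<close>)
  have "R p \<le> c"
  proof (rule field_le_epsilon)
    fix e :: real assume "0 < e"
    then have "p - e < Sup ?S" by (simp add: p_def)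
    then obtain y where y: "y \<in> ?S" "p - e < y"
      using less_cSup_iff[of ?S "p - e"] bdd ne by blast
    have "y \<le> p" unfolding p_def using y(1) bdd by (rule cSup_upper)
    then show "R p \<le> c + e"
      using R_lipschitz[of y p] y p0 p1 by auto
  qed
  then have "?S = {0..p}"
    using p0 p1 R_mono[of _ p] cSup_upper[OF _ bdd, folded p_def] by fastforce
  then show thesis using that p0 p1 by auto
qed

lemma expectation_on_event:
  assumes [measurable]: "A \<in> events"
  shows "expectation (\<lambda>\<omega>. indicator A \<omega> * \<tau> \<omega>) =
    (\<integral>s. prob (A \<inter> {\<omega>\<in>space M. s < \<tau> \<omega>}) \<partial>unit_lborel)"
proof -
  have "expectation (\<lambda>\<omega>. indicator A \<omega> * \<tau> \<omega>) =
      (\<integral>s. prob {\<omega>\<in>space M. s < indicator A \<omega> * \<tau> \<omega>} \<partial>unit_lborel)"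
    using rv_range by (intro expectation_layer_cake) (auto intro!: AE_I2 split: split_indicator)
  also have "\<dots> = (\<integral>s. prob (A \<inter> {\<omega>\<in>space M. s < \<tau> \<omega>}) \<partial>unit_lborel)"
    by (intro Bochner_Integration.integral_cong arg_cong[where f=prob]) (auto split: split_indicator_asm)
  finally show ?thesis .
qed

lemma integrable_prob_above:
  fixes X :: "'a \<Rightarrow> real"
  assumes [measurable]: "A \<in> events" "X \<in> borel_measurable M"
  shows "integrable unit_lborel (\<lambda>s. prob (A \<inter> {\<omega>\<in>space M. s < X \<omega>}))"
proof (rule unit_lborel.integrable_const_bound[where B=1])
  show "(\<lambda>s. prob (A \<inter> {\<omega>\<in>space M. s < X \<omega>})) \<in> borel_measurable unit_lborel"
    by (intro borel_measurable_unit_lborel_antimono_on monotone_onI finite_measure_mono) auto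
qed auto

text \<open>The rearrangement inequality: integrate the Bonferroni bound
  \<open>P(A \<inter> {\<tau> > s}) \<ge> P(A) + P(\<tau> > s) - 1\<close> over
  \<open>s\<close>.\<close>

lemma R_prob_le_expectation:
  assumes A [measurable]: "A \<in> events"
  shows "R (prob A) \<le> expectation (\<lambda>\<omega>. indicator A \<omega> * \<tau> \<omega>)"
proof -
  have "max 0 (tail s - 1 + prob A) \<le> prob (A \<inter> {\<omega>\<in>space M. s < \<tau> \<omega>})" if "0 \<le> s" for s
  proof -
    let ?B = "{\<omega>\<in>space M. s < \<tau> \<omega>}"
    have "prob (A \<union> ?B) = prob A + prob (?B - A)"
      by (subst finite_measure_Union[symmetric]) (auto intro!: arg_cong[where f=prob])
    moreover have "prob (?B - A) = prob ?B - prob (?B \<inter> A)"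
      by (rule finite_measure_Diff') auto
    ultimately show ?thesis
      using prob_le_1[of "A \<union> ?B"] tail_eq[OF that] by (simp add: Int_commute)
  qed
  then show ?thesis
    unfolding expectation_on_event[OF A] using R_eq[of "prob A"]
    by (auto intro!: integral_mono R_integrand_integrable integrable_prob_above)
qed

text \<open>Comparability gives equality in the Bonferroni bound at every level: either
  \<open>A\<close> lies in \<open>{\<tau> \<le> s}\<close> and the intersection is null, or
  \<open>A\<close> contains \<open>{\<tau> \<le> s}\<close> and the intersection has probability
  \<open>P(A) - P(\<tau> \<le> s)\<close>.\<close>

lemma expectation_le_R_prob:
  assumes A [measurable]: "A \<in> events"
    and cmp: "\<And>s. ae_comparable M A {\<omega>\<in>space M. \<tau> \<omega> \<le> s}"
  shows "expectation (\<lambda>\<omega>. indicator A \<omega> * \<tau> \<omega>) \<le> R (prob A)"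
proof -
  have "prob (A \<inter> {\<omega>\<in>space M. s < \<tau> \<omega>}) \<le> max 0 (tail s - 1 + prob A)" if "0 \<le> s" for s
  proof (cases "ae_subset M A {\<omega>\<in>space M. \<tau> \<omega> \<le> s}")
    case True
    then have "ae_subset M (A \<inter> {\<omega>\<in>space M. s < \<tau> \<omega>}) {}"
      by (auto simp: ae_subset_def elim!: AE_mp)
    then have "prob (A \<inter> {\<omega>\<in>space M. s < \<tau> \<omega>}) \<le> prob {}"
      by (rule prob_mono_ae_subset) simp
    then show ?thesis by simp
  next
    case False
    let ?C = "{\<omega>\<in>space M. \<tau> \<omega> \<le> s}"
    have "ae_subset M ?C A"
      using False cmp[of s] by (auto simp: ae_comparable_def)
    then have "ae_subset M ?C (?C \<inter> A)"
      by (auto simp: ae_subset_def elim!: AE_mp)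
    then have "prob ?C \<le> prob (A \<inter> ?C)"
      using prob_mono_ae_subset[of ?C "?C \<inter> A"] by (simp add: Int_commute)
    moreover have "prob (A - ?C) = prob A - prob (A \<inter> ?C)"
      by (rule finite_measure_Diff') auto
    moreover have "A - ?C = A \<inter> {\<omega>\<in>space M. s < \<tau> \<omega>}"
      using sets.sets_into_space[OF A] by auto
    moreover have "prob {\<omega>\<in>space M. s < \<tau> \<omega>} = 1 - prob ?C"
      by (subst prob_compl[symmetric]) (auto intro!: arg_cong[where f=prob])
    ultimately show ?thesis
      using tail_eq[OF that] by simp
  qed
  then show ?thesis
    unfolding expectation_on_event[OF A] using R_eq[of "prob A"]
    by (auto intro!: integral_mono R_integrand_integrable integrable_prob_above)
qed

end

section \<open>Increasing processes evaluated at a random time\<close>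

text \<open>A non-measurable set has measure 0 by convention, so the bound covers every subset. It
  is applied to the time sections of a process.\<close>

lemma measure_lborel_subset_upper_le:
  assumes "B \<subseteq> {a..1::real}" "a \<le> 1"
  shows "measure lborel B \<le> 1 - a"
proof (cases "B \<in> sets lborel")
  case True
  then have "measure lborel B \<le> measure lborel {a..1}"
    using assms by (intro measure_mono_fmeasurable) (auto simp: fmeasurable_def)
  then show ?thesis using assms by simp
next
  case False
  then show ?thesis using assms by (simp add: measure_notin_sets)
qed

section \<open>Lower bound and optimal process for the scale \<open>m\<close>\<close>

locale rv_with_scale = unit_rv +
  fixes m :: "real \<Rightarrow> real"
  assumes bij: "bij_betw m {0..1} {0..1}"
    and mono: "strict_mono_on {0..1} m"
begin

text \<open>The integrand of the claimed formula; it turns out to be the quantile function of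
  \<open>\<xi>\<^sub>\<tau>\<close> for the optimal process.\<close>

definition g :: "real \<Rightarrow> real" where
  "g y = inv_into {0..1} m (R y)"

lemma m_bounds: "s \<in> {0..1} \<Longrightarrow> m s \<in> {0..1}"
  using bij by (rule bij_betw_apply)

lemma m_le_iff: "s \<in> {0..1} \<Longrightarrow> t \<in> {0..1} \<Longrightarrow> m s \<le> m t \<longleftrightarrow> s \<le> t"
  using mono by (rule strict_mono_on_less_eq)

lemma m_1: "m 1 = 1"
proof -
  have "1 \<in> m ` {0..1}"
    using bij by (simp add: bij_betw_def)
  then obtain x where x: "x \<in> {0..1}" "m x = 1"
    by auto
  then have "1 \<le> m 1" using m_le_iff[of x 1] by simp
  then show ?thesis using m_bounds[of 1] by simp
qed

lemma g_bounds: "y \<in> {0..1} \<Longrightarrow> g y \<in> {0..1}"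
  unfolding g_def using R_bounds[of y] bij by (metis bij_betw_imp_surj_on inv_into_into)

lemma m_g: "y \<in> {0..1} \<Longrightarrow> m (g y) = R y"
  unfolding g_def using R_bounds[of y] bij by (metis bij_betw_imp_surj_on f_inv_into_f)

lemma g_le_iff: "y \<in> {0..1} \<Longrightarrow> s \<in> {0..1} \<Longrightarrow> g y \<le> s \<longleftrightarrow> R y \<le> m s"
  using m_le_iff[OF g_bounds, of y s] m_g[of y] by simp

lemma g_mono_on: "mono_on {0..1} g"
proof (rule monotone_onI)
  fix x y :: real assume xy: "x \<in> {0..1}" "y \<in> {0..1}" "x \<le> y"
  show "g x \<le> g y"
    unfolding g_le_iff[OF xy(1) g_bounds[OF xy(2)]] m_g[OF xy(2)] by (rule R_mono[OF xy])
qed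

lemma g_measurable [measurable]: "g \<in> borel_measurable unit_lborel"
  by (rule borel_measurable_unit_lborel_mono_on[OF g_mono_on])

lemma integral_g: "integral\<^sup>L unit_lborel g =
  (\<integral>s. measure unit_lborel {y\<in>space unit_lborel. s < g y} \<partial>unit_lborel)"
proof (rule unit_lborel.expectation_layer_cake[OF g_measurable], rule AE_I2)
  fix y assume "y \<in> space unit_lborel"
  then show "0 \<le> g y \<and> g y \<le> 1"
    using g_bounds[of y] by simp
qed

lemma process_at_rv:
  assumes "\<xi> \<in> process_class M m"
  shows "(\<lambda>\<omega>. \<xi> (\<tau> \<omega>) \<omega>) \<in> borel_measurable M"
    and "AE \<omega> in M. 0 \<le> \<xi> (\<tau> \<omega>) \<omega> \<and> \<xi> (\<tau> \<omega>) \<omega> \<le> 1"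
proof -
  have joint: "(\<lambda>(t, \<omega>). \<xi> t \<omega>) \<in> borel_measurable (restrict_space borel {0..1} \<Otimes>\<^sub>M M)"
    using assms by (simp add: process_class_def)
  have "\<tau> \<in> M \<rightarrow>\<^sub>M restrict_space borel {0..1}"
    using rv_range by (intro measurable_restrict_space2 rv) auto
  then have "(\<lambda>\<omega>. (\<tau> \<omega>, \<omega>)) \<in> M \<rightarrow>\<^sub>M restrict_space borel {0..1} \<Otimes>\<^sub>M M"
    by (rule measurable_Pair[OF _ measurable_ident_sets[OF refl]])
  from measurable_compose[OF this joint]
  show "(\<lambda>\<omega>. \<xi> (\<tau> \<omega>) \<omega>) \<in> borel_measurable M"
    by (simp only: prod.case)
  have "AE \<omega> in M. \<forall>s t. 0 \<le> s \<and> s < t \<and> t \<le> 1 \<longrightarrow>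
      0 \<le> \<xi> s \<omega> \<and> \<xi> s \<omega> \<le> \<xi> t \<omega> \<and> \<xi> t \<omega> \<le> 1"
    using assms by (simp add: process_class_def)
  then show "AE \<omega> in M. 0 \<le> \<xi> (\<tau> \<omega>) \<omega> \<and> \<xi> (\<tau> \<omega>) \<omega> \<le> 1"
    using AE_space
  proof eventually_elim
    case (elim \<omega>)
    \<comment> \<open>Path bounds are available only for pairs of times \<open>s < t\<close>, so
      \<open>\<tau> \<omega>\<close> is paired with 1 or with 0.\<close>
    have "\<tau> \<omega> < 1 \<or> 0 < \<tau> \<omega>" by auto
    then show ?case
    proof
      assume "\<tau> \<omega> < 1"
      with elim(1)[rule_format, of "\<tau> \<omega>" 1] rv_range[OF elim(2)] show ?thesis by auto
    next
      assume "0 < \<tau> \<omega>"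
      with elim(1)[rule_format, of 0 "\<tau> \<omega>"] rv_range[OF elim(2)] show ?thesis by auto
    qed
  qed
qed

text \<open>On the event \<open>\<xi>\<^sub>\<tau> \<le> s\<close> the path stays below \<open>s\<close> up to time \<open>\<tau>\<close>, so it exceeds
  \<open>s\<close> for a duration of at most \<open>1 - \<tau>\<close>.\<close>

lemma expectation_on_sublevel_le:
  assumes xi: "\<xi> \<in> process_class M m" and s: "s \<in> {0..1}"
  defines "A \<equiv> {\<omega>\<in>space M. \<xi> (\<tau> \<omega>) \<omega> \<le> s}"
  shows "expectation (\<lambda>\<omega>. indicator A \<omega> * \<tau> \<omega>) \<le> m s"
proof -
  note [measurable] = process_at_rv(1)[OF xi]
  have [measurable]: "A \<in> events" by (simp add: A_def)
  have int: "integrable M (\<lambda>\<omega>. indicator A \<omega> * \<tau> \<omega>)"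
    using rv_range by (intro integrable_const_bound[where B=1]) (auto intro!: AE_I2 split: split_indicator)
  have "AE \<omega> in M. \<forall>s t. 0 \<le> s \<and> s < t \<and> t \<le> 1 \<longrightarrow>
      0 \<le> \<xi> s \<omega> \<and> \<xi> s \<omega> \<le> \<xi> t \<omega> \<and> \<xi> t \<omega> \<le> 1"
    using xi by (simp add: process_class_def)
  then have le: "AE \<omega> in M. measure lborel {t\<in>{0..1}. \<xi> t \<omega> > s} \<le> 1 - indicator A \<omega> * \<tau> \<omega>"
    using AE_space
  proof eventually_elim
    case (elim \<omega>)
    \<comment> \<open>One formula serves both cases: off \<open>A\<close> the product is 0 and the
      claim is just \<open>t \<ge> 0\<close>.\<close>
    have *: "t \<ge> indicator A \<omega> * \<tau> \<omega>" if "t \<in> {0..1}" "s < \<xi> t \<omega>" for t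
    proof (cases "\<omega> \<in> A")
      case True
      then have "\<not> t < \<tau> \<omega>"
        using elim(1)[rule_format, of t "\<tau> \<omega>"] that rv_range[OF elim(2)] by (auto simp: A_def)
      with True show ?thesis by simp
    qed (use that in auto)
    then show ?case
      using rv_range[OF elim(2)]
      by (intro measure_lborel_subset_upper_le) (auto split: split_indicator)
  qed
  have "1 - m s \<le> (\<integral>\<omega>. measure lborel {t\<in>{0..1}. \<xi> t \<omega> > s} \<partial>M)"
    using xi s by (simp add: process_class_def)
  \<comment> \<open>The integral of a non-integrable function is 0 by convention, so the comparison
    rests on integrability and non-negativity of the larger function.\<close>
  also have "\<dots> \<le> (\<integral>\<omega>. 1 - indicator A \<omega> * \<tau> \<omega> \<partial>M)"
  proof (rule integral_mono_AE'[OF _ le])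
    show "integrable M (\<lambda>\<omega>. 1 - indicator A \<omega> * \<tau> \<omega>)"
      using int by simp
    show "AE \<omega> in M. 0 \<le> 1 - indicator A \<omega> * \<tau> \<omega>"
      using rv_range by (intro AE_I2) (auto split: split_indicator)
  qed
  also have "\<dots> = 1 - expectation (\<lambda>\<omega>. indicator A \<omega> * \<tau> \<omega>)"
    using int prob_space by (subst Bochner_Integration.integral_diff) auto
  finally show ?thesis by simp
qed

lemma integral_g_le:
  assumes xi: "\<xi> \<in> process_class M m"
  shows "integral\<^sup>L unit_lborel g \<le> (\<integral>\<omega>. \<xi> (\<tau> \<omega>) \<omega> \<partial>M)"
proof -
  note [measurable] = process_at_rv(1)[OF xi]
  let ?X = "\<lambda>\<omega>. \<xi> (\<tau> \<omega>) \<omega>"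
  \<comment> \<open>Both sides are integrals of tails, so they are compared level by level. With
    \<open>a = P(\<xi>\<^sub>\<tau> \<le> s)\<close> one has \<open>g a \<le> s\<close>;
    monotonicity confines \<open>{g > s}\<close> to \<open>{a..1}\<close>, of length
    \<open>P(\<xi>\<^sub>\<tau> > s)\<close>.\<close>
  have pt: "measure unit_lborel {y\<in>space unit_lborel. s < g y} \<le> prob {\<omega>\<in>space M. s < ?X \<omega>}"
    if s: "s \<in> {0..1}" for s
  proof -
    let ?A = "{\<omega>\<in>space M. ?X \<omega> \<le> s}"
    have "R (prob ?A) \<le> m s"
      using R_prob_le_expectation[of ?A] expectation_on_sublevel_le[OF xi s] by simp
    then have gA: "g (prob ?A) \<le> s"
      using s by (subst g_le_iff) auto
    have "{y\<in>space unit_lborel. s < g y} \<subseteq> {prob ?A..1}"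
    proof
      fix y assume y: "y \<in> {y\<in>space unit_lborel. s < g y}"
      then have "\<not> y \<le> prob ?A"
        using gA monotone_onD[OF g_mono_on, of y "prob ?A"] by auto
      with y show "y \<in> {prob ?A..1}" by simp
    qed
    then have "measure unit_lborel {y\<in>space unit_lborel. s < g y} \<le> measure unit_lborel {prob ?A..1}"
      by (intro unit_lborel.finite_measure_mono) (auto simp: sets_restrict_space_iff)
    also have "\<dots> = 1 - prob ?A"
      by (subst measure_unit_lborel) (auto intro: order_trans[OF measure_nonneg])
    also have "\<dots> = prob {\<omega>\<in>space M. s < ?X \<omega>}"
      by (subst prob_compl[symmetric]) (auto intro!: arg_cong[where f=prob])
    finally show ?thesis .
  qed
  have "integrable unit_lborel (\<lambda>s. prob (space M \<inter> {\<omega>\<in>space M. s < ?X \<omega>}))"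
    by (rule integrable_prob_above) auto
  then have "integrable unit_lborel (\<lambda>s. prob {\<omega>\<in>space M. s < ?X \<omega>})"
    by (rule Bochner_Integration.integrable_cong[THEN iffD1, rotated -1])
       (auto intro!: arg_cong[where f=prob])
  then show ?thesis
    unfolding integral_g expectation_layer_cake[OF process_at_rv[OF xi]]
    using pt by (intro integral_mono') auto
qed

lemma integral_g_attained:
  assumes at: "atomless M"
  obtains \<xi> where "\<xi> \<in> process_class M m" "(\<integral>\<omega>. \<xi> (\<tau> \<omega>) \<omega> \<partial>M) = integral\<^sup>L unit_lborel g"
proof -
  obtain U :: "'a \<Rightarrow> real" where U [measurable]: "U \<in> borel_measurable M"
    and U01: "\<And>\<omega>. U \<omega> \<in> {0..1}"
    and PU: "\<And>x. x \<in> {0..1} \<Longrightarrow> prob {\<omega>\<in>space M. U \<omega> \<le> x} = x"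
    and cmp: "\<And>x s. x \<in> {0..1} \<Longrightarrow>
      ae_comparable M {\<omega>\<in>space M. U \<omega> \<le> x} {\<omega>\<in>space M. \<tau> \<omega> \<le> s}"
    using exists_comonotone_uniform[OF at rv] by blast
  define h where "h \<omega> = g (U \<omega>)" for \<omega>
  have "U \<in> M \<rightarrow>\<^sub>M unit_lborel"
    using U01 by (intro measurable_restrict_space2) auto
  from measurable_compose[OF this g_measurable]
  have h [measurable]: "h \<in> borel_measurable M"
    unfolding h_def .
  have h01: "0 \<le> h \<omega>" "h \<omega> \<le> 1" for \<omega>
    using g_bounds[OF U01, of \<omega>] by (auto simp: h_def)
  \<comment> \<open>The same \<open>p\<close> describes the sublevel sets of \<open>g\<close> and of
    \<open>h\<close>. The first two equations give the value of the expectation, and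
    \<open>R p \<le> m s\<close> gives the constraint on the process.\<close>
  have level: "\<exists>p\<in>{0..1}. {y\<in>{0..1}. g y \<le> s} = {0..p} \<and>
      {\<omega>\<in>space M. h \<omega> \<le> s} = {\<omega>\<in>space M. U \<omega> \<le> p} \<and> R p \<le> m s" if s: "s \<in> {0..1}" for s
  proof -
    obtain p where p: "p \<in> {0..1}" "{y\<in>{0..1}. R y \<le> m s} = {0..p}"
      using R_sublevel[of "m s"] m_bounds[OF s] by auto
    then have gp: "{y\<in>{0..1}. g y \<le> s} = {0..p}"
      using g_le_iff[OF _ s] by auto
    moreover have "h \<omega> \<le> s \<longleftrightarrow> U \<omega> \<le> p" for \<omega>
      using U01[of \<omega>] gp by (auto simp: h_def set_eq_iff)
    moreover have "R p \<le> m s"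
      using p by (auto simp: set_eq_iff)
    ultimately show ?thesis using p(1) by auto
  qed
  \<comment> \<open>\<open>\<xi>\<close> is constant up to \<open>\<tau>\<close>, so that \<open>\<xi>\<^sub>\<tau> = g(U)\<close>, and jumps to 1
    immediately afterwards, which gives the level sets their greatest possible length.\<close>
  define \<xi> where "\<xi> t \<omega> = (if t \<le> \<tau> \<omega> then h \<omega> else 1)" for t \<omega>
  have "(\<integral>\<omega>. \<xi> (\<tau> \<omega>) \<omega> \<partial>M) = expectation h"
    by (simp add: \<xi>_def)
  also have "\<dots> = (\<integral>s. prob {\<omega>\<in>space M. s < h \<omega>} \<partial>unit_lborel)"
    using h01 by (intro expectation_layer_cake) auto
  also have "\<dots> = integral\<^sup>L unit_lborel g"
    unfolding integral_g
  proof (intro Bochner_Integration.integral_cong refl)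
    fix s assume "s \<in> space unit_lborel"
    then have s: "s \<in> {0..1}" by simp
    obtain p where p: "p \<in> {0..1}" "{y\<in>{0..1}. g y \<le> s} = {0..p}"
      "{\<omega>\<in>space M. h \<omega> \<le> s} = {\<omega>\<in>space M. U \<omega> \<le> p}"
      using level[OF s] by auto
    have "s < g y \<longleftrightarrow> p < y" if "y \<in> {0..1}" for y
    proof -
      have "y \<in> {y\<in>{0..1}. g y \<le> s} \<longleftrightarrow> y \<in> {0..p}" using p(2) by blast
      then show ?thesis using that by auto
    qed
    then have "{y\<in>space unit_lborel. s < g y} = {p<..1}"
      using p(1) by auto
    then have "measure unit_lborel {y\<in>space unit_lborel. s < g y} = 1 - p"
      using p(1) by (simp add: measure_unit_lborel subset_eq)
    moreover have "prob {\<omega>\<in>space M. s < h \<omega>} = 1 - prob {\<omega>\<in>space M. h \<omega> \<le> s}"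
      by (subst prob_compl[symmetric]) (auto intro!: arg_cong[where f=prob])
    ultimately show "prob {\<omega>\<in>space M. s < h \<omega>} = measure unit_lborel {y\<in>space unit_lborel. s < g y}"
      using p(1,3) PU by simp
  qed
  finally have eq: "(\<integral>\<omega>. \<xi> (\<tau> \<omega>) \<omega> \<partial>M) = integral\<^sup>L unit_lborel g" .
  have cond: "1 - m s \<le> (\<integral>\<omega>. measure lborel {t\<in>{0..1}. \<xi> t \<omega> > s} \<partial>M)" if s: "s \<in> {0..1}" for s
  \<comment> \<open>At \<open>s = 1\<close> the value 1 taken after \<open>\<tau>\<close> no longer
    exceeds the level, but the constraint is trivial there since \<open>m 1 = 1\<close>.\<close>
  proof (cases "s = 1")
    case True
    then show ?thesis by (simp add: m_1)
  next
    case False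
    then have s1: "s < 1" using s by simp
    obtain p where p: "p \<in> {0..1}" "{\<omega>\<in>space M. h \<omega> \<le> s} = {\<omega>\<in>space M. U \<omega> \<le> p}" "R p \<le> m s"
      using level[OF s] by auto
    let ?A = "{\<omega>\<in>space M. U \<omega> \<le> p}"
    have "(\<integral>\<omega>. measure lborel {t\<in>{0..1}. \<xi> t \<omega> > s} \<partial>M) = (\<integral>\<omega>. 1 - indicator ?A \<omega> * \<tau> \<omega> \<partial>M)"
    proof (intro Bochner_Integration.integral_cong refl)
      fix \<omega> assume w: "\<omega> \<in> space M"
      have hU: "s < h \<omega> \<longleftrightarrow> \<not> U \<omega> \<le> p"
      proof -
        have "\<omega> \<in> {\<omega>\<in>space M. h \<omega> \<le> s} \<longleftrightarrow> \<omega> \<in> {\<omega>\<in>space M. U \<omega> \<le> p}" using p(2) by simp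
        then show ?thesis using w by auto
      qed
      \<comment> \<open>On \<open>?A\<close> the path exceeds \<open>s\<close> exactly after
        \<open>\<tau>\<close>; off \<open>?A\<close> it already starts above
        \<open>s\<close>.\<close>
      have "{t\<in>{0..1}. \<xi> t \<omega> > s} = (if \<omega> \<in> ?A then {\<tau> \<omega><..1} else {0..1})"
        using hU w s1 rv_range[OF w] by (auto simp: \<xi>_def)
      then show "measure lborel {t\<in>{0..1}. \<xi> t \<omega> > s} = 1 - indicator ?A \<omega> * \<tau> \<omega>"
        using rv_range[OF w] by simp
    qed
    also have "\<dots> = 1 - expectation (\<lambda>\<omega>. indicator ?A \<omega> * \<tau> \<omega>)"
      using rv_range prob_space
      by (subst Bochner_Integration.integral_diff)
         (auto intro!: AE_I2 integrable_const_bound[where B=1] split: split_indicator)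
    \<comment> \<open>Comonotonicity of \<open>U\<close> and \<open>\<tau>\<close> enters here:
      \<open>?A\<close> is comparable with all \<open>{\<tau> \<le> s}\<close> and has probability
      \<open>p\<close>.\<close>
    also have "\<dots> \<ge> 1 - R p"
      using expectation_le_R_prob[OF _ cmp[OF p(1)]] PU[OF p(1)] by simp
    finally show ?thesis using p(3) by simp
  qed
  have [measurable]: "(\<lambda>t. t) \<in> borel_measurable (restrict_space borel {0..1::real})"
    by (intro measurable_restrict_space1) simp
  have "(\<lambda>(t, \<omega>). \<xi> t \<omega>) \<in> borel_measurable (restrict_space borel {0..1} \<Otimes>\<^sub>M M)"
    unfolding \<xi>_def by measurable
  moreover have "AE \<omega> in M. \<forall>s t. 0 \<le> s \<and> s < t \<and> t \<le> 1 \<longrightarrow>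
      0 \<le> \<xi> s \<omega> \<and> \<xi> s \<omega> \<le> \<xi> t \<omega> \<and> \<xi> t \<omega> \<le> 1"
    using h01 by (auto simp: \<xi>_def)
  ultimately have "\<xi> \<in> process_class M m"
    using cond by (simp add: process_class_def)
  with eq show thesis using that by blast
qed

text \<open>The lower bound is attained, so the infimum is a minimum; the optimal process also shows
  that the class is non-empty.\<close>

lemma INF_process_class:
  assumes "atomless M"
  shows "(INF \<xi>\<in>process_class M m. (\<integral>\<omega>. \<xi> (\<tau> \<omega>) \<omega> \<partial>M)) = integral\<^sup>L unit_lborel g"
proof -
  obtain \<xi> where "\<xi> \<in> process_class M m" "(\<integral>\<omega>. \<xi> (\<tau> \<omega>) \<omega> \<partial>M) = integral\<^sup>L unit_lborel g"
    using integral_g_attained[OF assms] .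
  then show ?thesis
    using integral_g_le by (intro cInf_eq_minimum) (auto intro!: image_eqI[of _ _ \<xi>])
qed

lemma LINT_inv_eq_integral_g:
  "(LINT y:{0..1}|lborel. inv_into {0..1} m (LINT s:{1 - y..1}|lborel. r s)) = integral\<^sup>L unit_lborel g"
  unfolding LINT_unit_lborel
  by (intro Bochner_Integration.integral_cong refl) (simp add: LINT_upper_unit_lborel g_def R_def)

end

text \<open>Exchange the order of integration: \<open>r s\<close> is counted for \<open>y\<close> in
  \<open>{1 - s..1}\<close>, an interval of length \<open>s\<close>.\<close>

lemma (in unit_rv) integral_R:
  "integral\<^sup>L unit_lborel R = (\<integral>s. r s * s \<partial>unit_lborel)"
proof -
  interpret P: pair_sigma_finite unit_lborel unit_lborel
    by unfold_locales
  interpret PP: pair_prob_space unit_lborel unit_lborel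
    by unfold_locales
  let ?f = "\<lambda>s y. if 1 - y \<le> s then r s else 0"
  have "integral\<^sup>L unit_lborel R = (\<integral>y. (\<integral>s. ?f s y \<partial>unit_lborel) \<partial>unit_lborel)"
    by (simp add: R_def[abs_def])
  also have "\<dots> = (\<integral>s. (\<integral>y. ?f s y \<partial>unit_lborel) \<partial>unit_lborel)"
  proof (rule P.Fubini_integral)
    show "integrable (unit_lborel \<Otimes>\<^sub>M unit_lborel) (\<lambda>(s, y). ?f s y)"
    proof (rule PP.integrable_const_bound[where B=1])
      show "AE x in unit_lborel \<Otimes>\<^sub>M unit_lborel. norm (case x of (s, y) \<Rightarrow> ?f s y) \<le> 1"
        using rearrangement_bounds by (intro AE_I2) (auto simp: space_pair_measure)
    qed measurable
  qed
  also have "\<dots> = (\<integral>s. r s * s \<partial>unit_lborel)"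
  proof (intro Bochner_Integration.integral_cong refl)
    fix s assume s: "s \<in> space unit_lborel"
    have "(\<integral>y. ?f s y \<partial>unit_lborel) = (\<integral>y. r s * indicator {1 - s..1} y \<partial>unit_lborel)"
      by (intro Bochner_Integration.integral_cong) (auto split: split_indicator)
    also have "\<dots> = r s * measure unit_lborel {1 - s..1}"
      using s by (simp add: Int_absorb2 subset_eq)
    also have "\<dots> = r s * s"
      using s by (subst measure_unit_lborel) auto
    finally show "(\<integral>y. ?f s y \<partial>unit_lborel) = r s * s" .
  qed
  finally show ?thesis .
qed

theorem theorem2:
  fixes M :: "'a measure" and m :: "real \<Rightarrow> real" and \<tau> :: "'a \<Rightarrow> real"
  assumes "prob_space M"
    and "atomless M"
    and "bij_betw m {0..1} {0..1}"
    and "strict_mono_on {0..1} m"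
    and "\<tau> \<in> borel_measurable M"
    and "\<And>\<omega>. \<omega> \<in> space M \<Longrightarrow> \<tau> \<omega> \<in> {0..1}"
  shows "(INF \<xi>\<in>process_class M m. (\<integral>\<omega>. \<xi> (\<tau> \<omega>) \<omega> \<partial>M)) =
           (LINT y:{0..1}|lborel.
              inv_into {0..1} m (LINT s:{1 - y..1}|lborel. rearrangement M \<tau> s))
       \<and> ((\<forall>t\<in>{0..1}. m t = t) \<longrightarrow>
          (INF \<xi>\<in>process_class M m. (\<integral>\<omega>. \<xi> (\<tau> \<omega>) \<omega> \<partial>M)) =
           (LINT s:{0..1}|lborel. rearrangement M \<tau> s * s))"
proof -
  interpret prob_space M by fact
  interpret rv_with_scale M \<tau> m
    using assms by unfold_locales auto
  have "integral\<^sup>L unit_lborel g = (LINT s:{0..1}|lborel. r s * s)" if id: "\<forall>t\<in>{0..1}. m t = t"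
  proof -
    \<comment> \<open>For the identity scale, \<open>m (g y) = R y\<close> reads
      \<open>g y = R y\<close>, because \<open>g y\<close> lies in [0,1].\<close>
    have "g y = R y" if "y \<in> {0..1}" for y
      using m_g[OF that] g_bounds[OF that] id by simp
    then have "integral\<^sup>L unit_lborel g = integral\<^sup>L unit_lborel R"
      by (intro Bochner_Integration.integral_cong) auto
    then show ?thesis by (simp add: integral_R LINT_unit_lborel)
  qed
  then show ?thesis
    using INF_process_class[OF assms(2)] LINT_inv_eq_integral_g by simp
qed

end
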